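(* Suppose $G$ is a finite group, $X$ is a metrizable compact $G$-space, and $\mu$ is a probability $G$-invariant Borel measure on $X$. For every finite $r$ we have (1) $ms(X,r)\ge ms(G\times I,r)$; (2) $ms(X,r)=ms(G\times I,r)$ if the measure $\mu$ is continuous and $|G\cdot x|=|G|$ for almost all $x\in X$.
   Context: Setting: a finite group $G$ acts on a compact space $X$ endowed with a probability Borel measure $\mu$ invariant under this action. For every finite $r$, $ms(X,r)$ is defined as the least upper bound of $\varepsilon>0$ such that for every measurable $r$-coloring of $X$ (a coloring whose color classes are $\mu$-measurable) there exists a monochromatic subset $A\subset X$ of measure $\mu(A)\ge\varepsilon$ such that $A=g\cdot A$ for some non-identity element $g\in G$. Here $I$ denotes the interval $[0,1]$ endowed with the standard Lebesgue measure $\lambda$. For a compact group $G$, the cylinder $G\times I$ is considered as a left $G$-space with action $g\cdot(h,t)=(gh,t)$ for $g\in G$, $(h,t)\in G\times I$, endowed with the product measure (Haar measure on $G$) $\times\lambda$; $ms(G\times I,r)$ is defined for this $G$-space in the same way. A measure $\mu$ on $X$ is called continuous if $\mu(\{x\})=0$ for every $x\in X$. $G\cdot x$ denotes the orbit of $x$. *)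

theory Defs
  imports "HOL-Probability.Probability" "HOL-Algebra.Group_Action"
begin

definition borel_of :: "'x topology \<Rightarrow> 'x measure" where
  "borel_of X = sigma (topspace X) {U. openin X U}"

text \<open>Joint continuity, when the finite group carries the discrete topology, amounts to continuity of each translation.\<close>

definition continuous_group_action ::
    "('g, 'm) monoid_scheme \<Rightarrow> 'x topology \<Rightarrow> ('g \<Rightarrow> 'x \<Rightarrow> 'x) \<Rightarrow> bool" where
  "continuous_group_action G X \<phi> \<longleftrightarrow>
     group_action G (topspace X) \<phi> \<and> (\<forall>g\<in>carrier G. continuous_map X X (\<phi> g))"

definition invariant_measure ::
    "('g, 'm) monoid_scheme \<Rightarrow> ('g \<Rightarrow> 'x \<Rightarrow> 'x) \<Rightarrow> 'x measure \<Rightarrow> bool" where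
  "invariant_measure G \<phi> M \<longleftrightarrow>
     (\<forall>g\<in>carrier G. \<forall>A\<in>sets M. emeasure M (\<phi> g ` A) = emeasure M A)"

definition continuous_measure :: "'x measure \<Rightarrow> bool" where
  "continuous_measure M \<longleftrightarrow> (\<forall>x\<in>space M. emeasure M {x} = 0)"

text \<open>
  Colour classes and monochromatic sets are measurable with respect to the completed measure.
  The supremum is taken in the extended nonnegative reals, so it is \<open>0\<close> when no
  \<open>\<epsilon> > 0\<close> qualifies (for instance when \<open>G\<close> is trivial and \<open>r > 0\<close>).
\<close>

definition ms ::
    "('g, 'm) monoid_scheme \<Rightarrow> ('g \<Rightarrow> 'x \<Rightarrow> 'x) \<Rightarrow> 'x measure \<Rightarrow> nat \<Rightarrow> ennreal" where
  "ms G \<phi> M r = Sup {\<epsilon>. 0 < \<epsilon> \<and>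
     (\<forall>f \<in> measurable (completion M) (count_space {..<r}).
        \<exists>A \<in> sets (completion M).
          (\<exists>c. \<forall>x\<in>A. f x = c) \<and>
          \<epsilon> \<le> emeasure (completion M) A \<and>
          (\<exists>g\<in>carrier G. g \<noteq> \<one>\<^bsub>G\<^esub> \<and> A = \<phi> g ` A))}"

text \<open>
  Normalized Haar measure of a finite group times Lebesgue measure on \<open>[0,1]\<close>, as a Borel
  measure on the cylinder; passing to Lebesgue measurable sets is done by the completion
  in the definition of \<open>ms\<close>.
\<close>

definition cylinder_measure :: "('g, 'm) monoid_scheme \<Rightarrow> ('g \<times> real) measure" where
  "cylinder_measure G =
     uniform_count_measure (carrier G) \<Otimes>\<^sub>M restrict_space lborel {0..1}"

definition cylinder_action :: "('g, 'm) monoid_scheme \<Rightarrow> 'g \<Rightarrow> 'g \<times> real \<Rightarrow> 'g \<times> real" where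
  "cylinder_action G g =
     restrict (\<lambda>(h, t). (g \<otimes>\<^bsub>G\<^esub> h, t)) (carrier G \<times> {0..1})"

end

theory Submission imports Defs "HOL-Algebra.Multiplicative_Group" begin

text \<open>
  For a coloring \<open>f\<close> and an element \<open>g\<close>, the largest \<open>g\<close>-invariant subset of a color class is
  the set of points whose whole \<open>\<langle>g\<rangle>\<close>-orbit has that color. Its measure depends only on the
  distribution of the random pattern \<open>h \<mapsto> f (h x)\<close> in \<open>{..<r}\<^sup>G\<close>. As every distribution on this finite
  set is realised by a measurable map on \<open>[0,1]\<close>, colorings of \<open>X\<close> can be copied to \<open>G \<times> I\<close>,
  which gives (1).

  For (2), almost all points of \<open>X\<close> have a basic neighborhood disjoint from its translates, so
  there is a Borel fundamental domain \<open>D\<close>. Composing an injective Borel map \<open>X \<rightarrow> \<real>\<close> with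
  the distribution function of its law on \<open>D\<close> yields a map \<open>D \<rightarrow> [0,1]\<close> with uniform law, because
  \<open>\<mu>\<close> has no atoms. It extends equivariantly to a measure preserving map \<open>X \<rightarrow> G \<times> I\<close>,
  along which colorings are pulled back.
\<close>

section \<open>Monochromatic invariant sets of a measure preserving action\<close>

text \<open>For \<open>g\<close> of finite order the natural powers already run through the whole
  cyclic group. The condition is a countable conjunction, which makes measurability
  immediate.\<close>

definition mono_part ::
    "('g, 'm) monoid_scheme \<Rightarrow> ('g \<Rightarrow> 'x \<Rightarrow> 'x) \<Rightarrow> 'x measure \<Rightarrow> ('x \<Rightarrow> nat) \<Rightarrow> 'g \<Rightarrow> nat \<Rightarrow> 'x set" where
  "mono_part G \<phi> M f g c = {x \<in> space M. \<forall>k::nat. f (\<phi> (g [^]\<^bsub>G\<^esub> k) x) = c}"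

text \<open>The common setting for \<open>X\<close> and the cylinder. Invariance is stated through
  preimages, the form in which null sets and slices are pulled back below.\<close>

locale pmp_action = prob_space M + group_action G "space M" \<phi>
  for G :: "('g, 'm) monoid_scheme" (structure) and M :: "'x measure" and \<phi> +
  assumes finite_carrier: "finite (carrier G)"
    and measurable_action: "g \<in> carrier G \<Longrightarrow> \<phi> g \<in> measurable M M"
    and emeasure_vimage_action:
      "g \<in> carrier G \<Longrightarrow> A \<in> sets M \<Longrightarrow> emeasure M (\<phi> g -` A \<inter> space M) = emeasure M A"
begin

sublocale group G
  using group_hom group_hom.axioms(1) by auto

lemma action_in_space: "g \<in> carrier G \<Longrightarrow> x \<in> space M \<Longrightarrow> \<phi> g x \<in> space M"
  using element_image by blast

lemma action_one: "x \<in> space M \<Longrightarrow> \<phi> \<one> x = x"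
  using id_eq_one by (metis restrict_apply')

lemma order_pos: "0 < order G"
  using finite_carrier order_gt_0_iff_finite by blast

lemma AE_action:
  assumes "g \<in> carrier G" "AE x in M. P x"
  shows "AE x in M. P (\<phi> g x)"
proof -
  obtain N where N: "{x \<in> space M. \<not> P x} \<subseteq> N" "emeasure M N = 0" "N \<in> sets M"
    using assms(2) by (rule AE_E)
  have "emeasure M (\<phi> g -` N \<inter> space M) = 0"
    using emeasure_vimage_action[OF assms(1) N(3)] N(2) by simp
  moreover have "\<phi> g -` N \<inter> space M \<in> sets M"
    using measurable_action[OF assms(1)] N(3) by (rule measurable_sets)
  moreover have "{x \<in> space M. \<not> P (\<phi> g x)} \<subseteq> \<phi> g -` N \<inter> space M"
    using N(1) action_in_space[OF assms(1)] by auto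
  ultimately show ?thesis by (intro AE_I)
qed

lemma sets_mono_part:
  assumes "f \<in> measurable M (count_space {..<r})" "g \<in> carrier G"
  shows "mono_part G \<phi> M f g c \<in> sets M"
proof -
  have "(\<lambda>x. f (\<phi> (g [^] k) x)) \<in> measurable M (count_space {..<r})" for k :: nat
    using measurable_compose[OF measurable_action assms(1)] assms(2) by simp
  from this[measurable] show ?thesis
    unfolding mono_part_def by measurable
qed

text \<open>By induction on the exponent, forward \<open>g\<close>-orbits starting in
  \<open>A\<close> stay in \<open>A\<close>. Together with \<open>image_mono_part\<close> this makes
  \<open>mono_part\<close> the largest \<open>g\<close>-invariant set inside a color class.\<close>

lemma invariant_subset_mono_part:
  assumes "g \<in> carrier G" "A \<subseteq> space M" "A = \<phi> g ` A" "\<forall>x\<in>A. f x = c"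
  shows "A \<subseteq> mono_part G \<phi> M f g c"
proof
  fix x assume x: "x \<in> A"
  have "\<phi> (g [^] k) x \<in> A" for k :: nat
  proof (induction k)
    case 0
    then show ?case using x assms(2) action_one by auto
  next
    case (Suc k)
    have "\<phi> (g [^] Suc k) x = \<phi> g (\<phi> (g [^] k) x)"
      using composition_rule[of x g "g [^] k"] x assms nat_pow_Suc2[of g k] by auto
    then show ?case using Suc assms(3) by auto
  qed
  then show "x \<in> mono_part G \<phi> M f g c"
    using x assms by (auto simp: mono_part_def)
qed

lemma image_mono_part:
  assumes "g \<in> carrier G"
  shows "\<phi> g ` mono_part G \<phi> M f g c = mono_part G \<phi> M f g c" (is "_ ` ?E = _")
proof -
  have shift: "\<phi> (g [^] m) x \<in> ?E" if "x \<in> ?E" for x and m :: nat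
  proof -
    have "\<phi> (g [^] k) (\<phi> (g [^] m) x) = \<phi> (g [^] (k + m)) x" for k :: nat
      using composition_rule[of x "g [^] k" "g [^] m"] that assms
      by (simp add: nat_pow_mult mono_part_def)
    then show ?thesis
      using that assms action_in_space by (auto simp: mono_part_def)
  qed
  have "\<phi> g x \<in> ?E" if "x \<in> ?E" for x
    using shift[OF that, of 1] assms by simp
  moreover have "x \<in> \<phi> g ` ?E" if "x \<in> ?E" for x
  proof -
    \<comment> \<open>The power \<open>order G - 1\<close> plays the role of the inverse of
      \<open>g\<close>, so a preimage of \<open>x\<close> is found without leaving the natural
      powers.\<close>
    have "\<phi> g (\<phi> (g [^] (order G - 1)) x) = \<phi> (g [^] order G) x"
      using composition_rule[of x g "g [^] (order G - 1)"] that assms nat_pow_Suc2[of g "order G - 1"]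
        order_pos by (auto simp: mono_part_def)
    also have "\<dots> = x"
      using that assms pow_order_eq_1 action_one by (simp add: mono_part_def)
    finally show ?thesis
      using shift[OF that, of "order G - 1"] by (metis image_eqI)
  qed
  ultimately show ?thesis by auto
qed

lemma completion_ex_measurable_colouring:
  fixes f :: "'x \<Rightarrow> nat"
  assumes "f \<in> measurable (completion M) (count_space {..<r})"
  obtains f' where "f' \<in> measurable M (count_space {..<r})" "AE x in M. f x = f' x"
proof -
  obtain x where "x \<in> space M" using not_empty by auto
  then have "f x < r" using measurable_space[OF assms] by auto
  have "(\<lambda>x. real (f x)) \<in> borel_measurable (completion M)"
    using measurable_compose[OF assms, of real borel] by simp
  then obtain h where h [measurable]: "h \<in> borel_measurable M" and eq: "AE x in M. real (f x) = h x"
    using completion_ex_borel_measurable_real by blast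
  \<comment> \<open>Rounding the real-valued Borel version \<open>h\<close> down returns to natural
    numbers. Values outside the palette are sent to color 0, which is legal because
    \<open>f x < r\<close> at some point gives \<open>0 < r\<close>.\<close>
  define f' where "f' x = (if nat \<lfloor>h x\<rfloor> < r then nat \<lfloor>h x\<rfloor> else 0)" for x
  have "f' \<in> measurable M (count_space UNIV)"
    unfolding f'_def by measurable
  then have "f' \<in> measurable M (count_space {..<r})"
    using \<open>f x < r\<close> measurable_sets[of f' M "count_space UNIV"]
    by (intro measurableI) (auto simp: f'_def)
  moreover have "AE x in M. f x = f' x"
    using eq AE_space
  proof eventually_elim
    case (elim x)
    then have "f x < r" using measurable_space[OF assms] by auto
    then show ?case using elim(1)[symmetric] by (simp add: f'_def)
  qed
  ultimately show ?thesis by (rule that)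
qed

text \<open>Removes both the completion and the choice of the set \<open>A\<close>. The best
  \<open>A\<close> is a \<open>mono_part\<close>, and changing a coloring on a null set changes each
  \<open>mono_part\<close> only by a null set, since the action preserves null sets.\<close>

lemma ms_eq:
  "ms G \<phi> M r = Sup {\<epsilon>. 0 < \<epsilon> \<and>
     (\<forall>f \<in> measurable M (count_space {..<r}).
        \<exists>c. \<exists>g\<in>carrier G. g \<noteq> \<one> \<and> \<epsilon> \<le> emeasure M (mono_part G \<phi> M f g c))}"
proof -
  have from_completion: "\<exists>c. \<exists>g\<in>carrier G. g \<noteq> \<one> \<and> \<epsilon> \<le> emeasure M (mono_part G \<phi> M f g c)"
    if f: "f \<in> measurable M (count_space {..<r})"
      and A: "A \<in> sets (completion M)" "\<forall>x\<in>A. f x = c"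
        "\<epsilon> \<le> emeasure (completion M) A" "g \<in> carrier G" "g \<noteq> \<one>" "A = \<phi> g ` A" for f A c g \<epsilon>
  proof -
    have "A \<subseteq> space M" using A(1) sets.sets_into_space by fastforce
    then have "A \<subseteq> mono_part G \<phi> M f g c"
      using A by (intro invariant_subset_mono_part) auto
    then have "emeasure (completion M) A \<le> emeasure (completion M) (mono_part G \<phi> M f g c)"
      using sets_mono_part[OF f A(4)] by (intro emeasure_mono) auto
    also have "\<dots> = emeasure M (mono_part G \<phi> M f g c)"
      using sets_mono_part[OF f A(4)] by simp
    finally have "\<epsilon> \<le> emeasure M (mono_part G \<phi> M f g c)"
      using A(3) by (rule order_trans[rotated])
    then show ?thesis using A by blast
  qed
  have to_completion: "\<exists>A \<in> sets (completion M). (\<exists>c. \<forall>x\<in>A. f x = c) \<and>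
          \<epsilon> \<le> emeasure (completion M) A \<and> (\<exists>g\<in>carrier G. g \<noteq> \<one> \<and> A = \<phi> g ` A)"
    if f: "f \<in> measurable (completion M) (count_space {..<r})"
      and *: "\<And>f. f \<in> measurable M (count_space {..<r}) \<Longrightarrow>
        \<exists>c. \<exists>g\<in>carrier G. g \<noteq> \<one> \<and> \<epsilon> \<le> emeasure M (mono_part G \<phi> M f g c)" for f \<epsilon>
  proof -
    obtain f' where f': "f' \<in> measurable M (count_space {..<r})" "AE x in M. f x = f' x"
      using completion_ex_measurable_colouring[OF f] .
    obtain c g where g: "g \<in> carrier G" "g \<noteq> \<one>" "\<epsilon> \<le> emeasure M (mono_part G \<phi> M f' g c)"
      using *[OF f'(1)] by blast
    let ?A = "mono_part G \<phi> M f g c" and ?B = "mono_part G \<phi> M f' g c"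
    \<comment> \<open>Countably many null sets are discarded, so that the two colorings agree along
      the entire \<open>g\<close>-orbit of almost every point.\<close>
    have "AE x in M. \<forall>k::nat. f (\<phi> (g [^] k) x) = f' (\<phi> (g [^] k) x)"
      unfolding AE_all_countable using AE_action[OF nat_pow_closed[OF g(1)] f'(2)] by blast
    then have ae: "AE x in M. x \<in> ?A \<longleftrightarrow> x \<in> ?B"
      by eventually_elim (auto simp: mono_part_def)
    have B: "?B \<in> sets M" using sets_mono_part[OF f'(1) g(1)] .
    \<comment> \<open>The witness has to be exactly monochromatic for \<open>f\<close> and exactly
      invariant, so \<open>?A\<close> is used and not \<open>?B\<close>; only its measurability and
      its measure are borrowed from \<open>?B\<close>.\<close>
    have A: "?A \<in> sets (completion M)"
    proof (rule completion.in_sets_AE)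
      show "AE x in completion M. x \<in> ?B \<longleftrightarrow> x \<in> ?A"
        using ae by (auto simp: AE_completion_iff)
    qed (use B in \<open>auto simp: mono_part_def\<close>)
    moreover have "emeasure (completion M) ?A = emeasure M ?B"
      using emeasure_eq_AE[of ?A ?B "completion M"] ae A B by (simp add: AE_completion_iff)
    moreover have "f x = c" if "x \<in> ?A" for x
    proof -
      have "f (\<phi> (g [^] (0::nat)) x) = c" "x \<in> space M"
        using that unfolding mono_part_def by blast+
      then show ?thesis using action_one by simp
    qed
    ultimately show ?thesis
      using g image_mono_part[OF g(1), of f c] by (intro bexI[of _ ?A] conjI exI[of _ c] bexI[of _ g]) auto
  qed
  have "(\<forall>f \<in> measurable (completion M) (count_space {..<r}). \<exists>A \<in> sets (completion M).
        (\<exists>c. \<forall>x\<in>A. f x = c) \<and> \<epsilon> \<le> emeasure (completion M) A \<and>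
        (\<exists>g\<in>carrier G. g \<noteq> \<one> \<and> A = \<phi> g ` A)) \<longleftrightarrow>
      (\<forall>f \<in> measurable M (count_space {..<r}).
        \<exists>c. \<exists>g\<in>carrier G. g \<noteq> \<one> \<and> \<epsilon> \<le> emeasure M (mono_part G \<phi> M f g c))"
    (is "?L \<longleftrightarrow> ?R") for \<epsilon>
  proof
    assume L: ?L
    show ?R
    proof
      fix f assume f: "f \<in> measurable M (count_space {..<r})"
      obtain A c g where "A \<in> sets (completion M)" "\<forall>x\<in>A. f x = c"
        "\<epsilon> \<le> emeasure (completion M) A" "g \<in> carrier G" "g \<noteq> \<one>" "A = \<phi> g ` A"
        using bspec[OF L measurable_completion[OF f]] by blast
      then show "\<exists>c. \<exists>g\<in>carrier G. g \<noteq> \<one> \<and> \<epsilon> \<le> emeasure M (mono_part G \<phi> M f g c)"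
        by (rule from_completion[OF f])
    qed
  next
    assume R: ?R
    show ?L
      by (intro ballI to_completion) (use R in blast)+
  qed
  then show ?thesis
    unfolding ms_def by (simp only:)
qed

end

section \<open>The cylinder as a measure preserving action\<close>

text \<open>All summands agree by invariance. The sum has the shape of
  \<open>emeasure_cylinder_measure\<close>, so measures on \<open>X\<close> and on the cylinder can
  be compared summand by summand.\<close>

lemma (in pmp_action) emeasure_average:
  assumes "E \<in> sets M"
  shows "emeasure M E =
    (\<Sum>h\<in>carrier G. ennreal (1 / order G) * emeasure M (\<phi> h -` E \<inter> space M))"
proof -
  have "(\<Sum>h\<in>carrier G. ennreal (1 / order G) * emeasure M (\<phi> h -` E \<inter> space M)) =
      ennreal (real (order G)) * ennreal (1 / order G) * emeasure M E"
    using assms emeasure_vimage_action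
    by (simp add: order_def ennreal_of_nat_eq_real_of_nat mult.assoc)
  also have "\<dots> = emeasure M E"
    using order_pos by (simp flip: ennreal_mult')
  finally show ?thesis by simp
qed

lemma space_cylinder_measure: "space (cylinder_measure G) = carrier G \<times> {0..1}"
  by (simp add: cylinder_measure_def space_pair_measure space_uniform_count_measure space_restrict_space)

lemma sets_cylinder_measure:
  "sets (cylinder_measure G) = sets (count_space (carrier G) \<Otimes>\<^sub>M restrict_space borel {0..1})"
  unfolding cylinder_measure_def
  by (intro sets_pair_measure_cong sets_uniform_count_measure_count_space sets_restrict_space_cong) simp

lemma measurable_cylinder_measureI:
  assumes "finite (carrier G)"
    and "\<And>h. h \<in> carrier G \<Longrightarrow> (\<lambda>t. f (h, t)) \<in> measurable (restrict_space borel {0..1}) N"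
  shows "f \<in> measurable (cylinder_measure G) N"
  using measurable_pair_measure_countable1[of "carrier G" f "restrict_space borel {0..1}" N] assms
  by (simp add: measurable_cong_sets[OF sets_cylinder_measure refl] countable_finite)

lemma prob_space_lborel_01: "prob_space (restrict_space lborel {0..1::real})"
  by (rule prob_spaceI) (simp add: space_restrict_space emeasure_restrict_space)

lemma sets_cylinder_section:
  assumes "B \<in> sets (cylinder_measure G)"
  shows "Pair h -` B \<in> sets borel" "Pair h -` B \<subseteq> {0..1}"
proof -
  show "Pair h -` B \<in> sets borel"
    using sets_Pair1[OF assms[unfolded cylinder_measure_def], of h]
    by (auto simp: sets_restrict_space_iff)
  show "Pair h -` B \<subseteq> {0..1}"
    using sets.sets_into_space[OF assms] by (auto simp: space_cylinder_measure)
qed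

lemma emeasure_cylinder_measure:
  assumes "finite (carrier G)" "B \<in> sets (cylinder_measure G)"
  shows "emeasure (cylinder_measure G) B =
    (\<Sum>h\<in>carrier G. ennreal (1 / order G) * emeasure lborel (Pair h -` B))"
proof -
  interpret L: prob_space "restrict_space lborel {0..1::real}"
    by (rule prob_space_lborel_01)
  have "emeasure (cylinder_measure G) B = (\<integral>\<^sup>+ h. emeasure (restrict_space lborel {0..1}) (Pair h -` B)
      \<partial>uniform_count_measure (carrier G))"
    using assms unfolding cylinder_measure_def by (intro L.emeasure_pair_measure_alt)
  also have "\<dots> = (\<integral>\<^sup>+ h. emeasure lborel (Pair h -` B) \<partial>uniform_count_measure (carrier G))"
    using sets_cylinder_section[OF assms(2)] by (intro nn_integral_cong emeasure_restrict_space) auto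
  also have "\<dots> = (\<Sum>h\<in>carrier G. ennreal (1 / order G) * emeasure lborel (Pair h -` B))"
    using assms(1) unfolding uniform_count_measure_def order_def by (rule nn_integral_point_measure_finite)
  finally show ?thesis .
qed

lemma cylinder_action_apply:
  "h \<in> carrier G \<Longrightarrow> t \<in> {0..1} \<Longrightarrow> cylinder_action G g (h, t) = (g \<otimes>\<^bsub>G\<^esub> h, t)"
  by (simp add: cylinder_action_def)

lemma (in group) inv_mult_cancel_left:
  "g \<in> carrier G \<Longrightarrow> h \<in> carrier G \<Longrightarrow> inv g \<otimes> (g \<otimes> h) = h"
  "g \<in> carrier G \<Longrightarrow> h \<in> carrier G \<Longrightarrow> g \<otimes> (inv g \<otimes> h) = h"
  by (metis inv_closed l_inv l_one m_assoc, metis inv_closed r_inv l_one m_assoc)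

lemma (in group) group_action_cylinder_action:
  "group_action G (carrier G \<times> {0..1}) (cylinder_action G)"
proof -
  let ?E = "carrier G \<times> {0..1::real}"
  have bij: "bij_betw (cylinder_action G g) ?E ?E" if "g \<in> carrier G" for g
    using that
    by (intro bij_betw_byWitness[where f' = "cylinder_action G (inv g)"])
       (auto simp: cylinder_action_apply inv_mult_cancel_left)
  then have Bij: "cylinder_action G g \<in> Bij ?E" if "g \<in> carrier G" for g
    using that by (auto simp: Bij_def cylinder_action_def)
  have "cylinder_action G \<in> hom G (BijGroup ?E)"
  proof (rule homI)
    fix g h assume gh: "g \<in> carrier G" "h \<in> carrier G"
    \<comment> \<open>\<open>BijGroup\<close> consists of extensional maps, so equality must also
      hold off the cylinder, where both sides are \<open>undefined\<close>.\<close>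
    have "cylinder_action G (g \<otimes> h) z = compose ?E (cylinder_action G g) (cylinder_action G h) z" for z
    proof (cases "z \<in> ?E")
      case True
      then show ?thesis using gh by (auto simp: cylinder_action_apply compose_def m_assoc)
    next
      case False
      then show ?thesis by (simp only: cylinder_action_def compose_def restrict_def if_False)
    qed
    then show "cylinder_action G (g \<otimes> h) = cylinder_action G g \<otimes>\<^bsub>BijGroup ?E\<^esub> cylinder_action G h"
      using gh Bij by (auto simp: BijGroup_def)
  qed (use Bij in \<open>auto simp: BijGroup_def\<close>)
  then show ?thesis
    by (intro group_action.intro group_hom.intro group_hom_axioms.intro group_BijGroup is_group)
qed

text \<open>Translation by \<open>g\<close> permutes the slices, all of the same weight, so the
  slicewise formula for the measure is merely reindexed.\<close>

lemma (in group) pmp_action_cylinder: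
  assumes fin: "finite (carrier G)"
  shows "pmp_action G (cylinder_measure G) (cylinder_action G)"
proof -
  have "prob_space (cylinder_measure G)"
    unfolding cylinder_measure_def
    using prob_space_uniform_count_measure[OF fin] prob_space_lborel_01
    by (intro prob_space_pair) auto
  moreover have meas: "cylinder_action G g \<in> measurable (cylinder_measure G) (cylinder_measure G)"
    if g: "g \<in> carrier G" for g
  proof (rule measurable_cylinder_measureI[OF fin])
    fix h assume h: "h \<in> carrier G"
    have "(\<lambda>t. (g \<otimes> h, t)) \<in> measurable (restrict_space borel {0..1}) (cylinder_measure G)"
      using g h by (simp add: measurable_cong_sets[OF refl sets_cylinder_measure])
    then show "(\<lambda>t. cylinder_action G g (h, t)) \<in> measurable (restrict_space borel {0..1}) (cylinder_measure G)"
      using h by (subst measurable_cong[where g = "\<lambda>t. (g \<otimes> h, t)"])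
        (auto simp: cylinder_action_apply space_restrict_space)
  qed
  moreover have "emeasure (cylinder_measure G) (cylinder_action G g -` A \<inter> space (cylinder_measure G)) =
      emeasure (cylinder_measure G) A"
    if g: "g \<in> carrier G" and A: "A \<in> sets (cylinder_measure G)" for g A
  proof -
    have "Pair h -` (cylinder_action G g -` A \<inter> space (cylinder_measure G)) = Pair (g \<otimes> h) -` A"
      if "h \<in> carrier G" for h
      using that sets.sets_into_space[OF A]
      by (auto simp: space_cylinder_measure cylinder_action_apply)
    then have "emeasure (cylinder_measure G) (cylinder_action G g -` A \<inter> space (cylinder_measure G)) =
        (\<Sum>h\<in>carrier G. ennreal (1 / order G) * emeasure lborel (Pair (g \<otimes> h) -` A))"
      using emeasure_cylinder_measure[OF fin measurable_sets[OF meas[OF g] A]] by simp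
    also have "\<dots> = (\<Sum>h\<in>carrier G. ennreal (1 / order G) * emeasure lborel (Pair h -` A))"
      using g by (intro sum.reindex_bij_witness[where i = "\<lambda>h. inv g \<otimes> h" and j = "\<lambda>h. g \<otimes> h"])
        (auto simp: inv_mult_cancel_left)
    also have "\<dots> = emeasure (cylinder_measure G) A"
      using emeasure_cylinder_measure[OF fin A] by simp
    finally show ?thesis .
  qed
  ultimately show ?thesis
    using group_action_cylinder_action fin
    by (intro pmp_action.intro pmp_action_axioms.intro) (auto simp: space_cylinder_measure)
qed

lemma (in group) Pair_vimage_mono_part_cylinder:
  assumes "g \<in> carrier G" "h \<in> carrier G"
  shows "Pair h -` mono_part G (cylinder_action G) (cylinder_measure G) f g c =
    {t \<in> {0..1}. \<forall>k::nat. f (g [^] k \<otimes> h, t) = c}"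
  using assms by (auto simp: mono_part_def space_cylinder_measure cylinder_action_apply)

section \<open>Copying colorings of \<open>X\<close> to the cylinder\<close>

text \<open>A parameter \<open>t\<close> draws a pattern with the law of \<open>p\<close>, and
  \<open>(h, t)\<close> receives its coordinate at \<open>h\<close>. The slice at \<open>h\<close>
  of the new \<open>mono_part\<close> then has the probability that a pattern equals
  \<open>c\<close> at all \<open>g [^] k \<otimes> h\<close>, which is the measure of the
  \<open>\<phi> h\<close>-preimage of the old one.\<close>

lemma (in pmp_action) ex_cylinder_colouring:
  assumes f: "f \<in> measurable M (count_space {..<r})"
  obtains f' where "f' \<in> measurable (cylinder_measure G) (count_space {..<r})"
    "\<And>g c. g \<in> carrier G \<Longrightarrow>
      emeasure (cylinder_measure G) (mono_part G (cylinder_action G) (cylinder_measure G) f' g c) =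
      emeasure M (mono_part G \<phi> M f g c)"
proof -
  interpret C: pmp_action G "cylinder_measure G" "cylinder_action G"
    by (rule pmp_action_cylinder[OF finite_carrier])
  obtain x0 where "x0 \<in> space M" using not_empty by auto
  then have r: "0 < r" using measurable_space[OF f] by fastforce
  define P where "P = (carrier G \<rightarrow>\<^sub>E {..<r})"
  define p where "p x = (\<lambda>h\<in>carrier G. f (\<phi> h x))" for x
  have P: "finite P" unfolding P_def using finite_carrier by (intro finite_PiE) auto
  \<comment> \<open>Decodes the index of a pattern. Indices beyond \<open>card P\<close> get the
    constant pattern 0, so every \<open>D i\<close> takes legal colors on the group.\<close>
  define D where "D i = (if i < card P then from_nat_into P i else (\<lambda>_. 0))" for i
  have pP: "p x \<in> P" if "x \<in> space M" for x
    using that measurable_space[OF f action_in_space] by (auto simp: p_def P_def)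
  have D_less: "D i h < r" if "h \<in> carrier G" for i h
  proof (cases "i < card P")
    case True
    then have "from_nat_into P i \<in> P" by (intro from_nat_into) auto
    then show ?thesis using that True by (auto simp: D_def P_def)
  qed (use r in \<open>simp add: D_def\<close>)
  have D_p: "D (to_nat_on P (p x)) = p x" if "x \<in> space M" for x
    using to_nat_on_finite[OF P] pP[OF that] P
    by (auto simp: D_def bij_betw_def countable_finite)
  have meas_p: "(\<lambda>x. to_nat_on P (p x)) \<in> measurable M (count_space UNIV)"
  proof -
    have [measurable]: "Measurable.pred M (\<lambda>x. f (\<phi> h x) = j)" if "h \<in> carrier G" for h j
      using measurable_compose[OF measurable_action[OF that] f] by measurable
    have "p -` {q} \<inter> space M \<in> sets M" if "q \<in> P" for q
    proof -
      have "p -` {q} \<inter> space M = {x \<in> space M. \<forall>h\<in>carrier G. f (\<phi> h x) = q h}"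
      proof -
        have "p x = q \<longleftrightarrow> (\<forall>h\<in>carrier G. f (\<phi> h x) = q h)" for x
          using extensionalityI[of "p x" "carrier G" q] that by (auto simp: p_def P_def PiE_def)
        then show ?thesis by auto
      qed
      also have "\<dots> \<in> sets M"
        using finite_carrier by measurable
      finally show ?thesis .
    qed
    then have "p \<in> measurable M (count_space P)"
      using pP by (subst measurable_count_space_eq2[OF P]) auto
    then show ?thesis
      by (rule measurable_compose) simp
  qed
  \<comment> \<open>The law of the coded pattern, as a real distribution. Its quantile function
    \<open>N.I\<close> carries the uniform measure on the open unit interval to
    \<open>N\<close>.\<close>
  define N where "N = distr M borel (\<lambda>x. real (to_nat_on P (p x)))"
  have meas_rp: "(\<lambda>x. real (to_nat_on P (p x))) \<in> borel_measurable M"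
    using meas_p by simp
  interpret N: cdf_distribution N
    unfolding N_def by (intro cdf_distribution.intro real_distribution_distr meas_rp)
  \<comment> \<open>The quantile function is controlled only strictly between 0 and 1; the two
    endpoints form a null set and get a default value.\<close>
  define I where "I t = (if t \<in> {0<..<1} then N.I t else 0)" for t
  have I [measurable]: "I \<in> borel_measurable borel"
    unfolding I_def using N.measurable_CI by (subst measurable_restrict_space_iff[symmetric]) auto
  define f' where "f' = (\<lambda>(h, t). D (nat \<lfloor>I t\<rfloor>) h)"
  have f': "f' \<in> measurable (cylinder_measure G) (count_space {..<r})"
  proof (rule measurable_cylinder_measureI[OF finite_carrier])
    fix h assume h: "h \<in> carrier G"
    have "(\<lambda>i. D i h) \<in> measurable (count_space UNIV) (count_space {..<r})"
      using D_less[OF h] by simp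
    moreover have "(\<lambda>t. nat \<lfloor>I t\<rfloor>) \<in> measurable (restrict_space borel {0..1}) (count_space UNIV)"
      by (intro measurable_restrict_space1) measurable
    ultimately show "(\<lambda>t. f' (h, t)) \<in> measurable (restrict_space borel {0..1}) (count_space {..<r})"
      unfolding f'_def by (auto intro: measurable_compose)
  qed
  show ?thesis
  proof (rule that[OF f'])
    fix g c assume g: "g \<in> carrier G"
    let ?E = "mono_part G \<phi> M f g c"
    let ?E' = "mono_part G (cylinder_action G) (cylinder_measure G) f' g c"
    have "emeasure lborel (Pair h -` ?E') = emeasure M (\<phi> h -` ?E \<inter> space M)"
      if h: "h \<in> carrier G" for h
    proof -
      \<comment> \<open>The codes of patterns that are constantly \<open>c\<close> on the coset of
        \<open>h\<close> under the powers of \<open>g\<close>. Both the slice and the preimage in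
        \<open>X\<close> are events of this form.\<close>
      define S where "S = {y :: real. \<forall>k::nat. D (nat \<lfloor>y\<rfloor>) (g [^] k \<otimes> h) = c}"
      have S: "S \<in> sets (borel :: real measure)"
        unfolding S_def by measurable
      have "emeasure lborel (Pair h -` ?E') = emeasure lborel {t \<in> {0..1}. I t \<in> S}"
        using g h by (simp add: Pair_vimage_mono_part_cylinder f'_def S_def)
      also have "\<dots> = emeasure lborel {t \<in> {0<..<1}. I t \<in> S}"
        using S AE_lborel_singleton[of "0::real"] AE_lborel_singleton[of "1::real"]
        by (intro emeasure_eq_AE) (auto elim!: eventually_elim2)
      also have "\<dots> = emeasure lborel {t \<in> {0<..<1}. N.I t \<in> S}"
        by (intro arg_cong[of _ _ "emeasure lborel"]) (auto simp: I_def)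
      also have "\<dots> = emeasure (distr (restrict_space lborel {0<..<1}) borel N.I) S"
        using S N.measurable_CI
        by (subst emeasure_distr)
           (auto simp: emeasure_restrict_space space_restrict_space
                 cong: measurable_cong_sets intro!: arg_cong[of _ _ "emeasure lborel"])
      also have "\<dots> = emeasure N S"
        by (simp add: N.distr_I_eq_M)
      also have "\<dots> = emeasure M {x \<in> space M. real (to_nat_on P (p x)) \<in> S}"
        unfolding N_def using S meas_rp
        by (subst emeasure_distr) (auto intro!: arg_cong[of _ _ "emeasure M"])
      also have "{x \<in> space M. real (to_nat_on P (p x)) \<in> S} = \<phi> h -` ?E \<inter> space M"
      proof -
        have "D (to_nat_on P (p x)) (g [^] k \<otimes> h) = f (\<phi> (g [^] k) (\<phi> h x))"
          if "x \<in> space M" for x and k :: nat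
          using that g h by (simp add: D_p) (simp add: p_def composition_rule)
        then show ?thesis
          using h by (auto simp: S_def mono_part_def action_in_space)
      qed
      finally show ?thesis .
    qed
    then show "emeasure (cylinder_measure G) ?E' = emeasure M ?E"
      using emeasure_average[OF sets_mono_part[OF f g]]
      by (simp add: emeasure_cylinder_measure[OF finite_carrier C.sets_mono_part[OF f' g]])
  qed
qed

text \<open>Colorings travel from \<open>M\<close> to \<open>M'\<close> and the inequality goes the
  other way: a bound guaranteed for every coloring of \<open>M'\<close> holds for the transferred
  one, hence for the original.\<close>

lemma ms_mono:
  assumes "pmp_action G M \<phi>" "pmp_action G M' \<phi>'"
    and "\<And>f. f \<in> measurable M (count_space {..<r}) \<Longrightarrow>
      \<exists>f' \<in> measurable M' (count_space {..<r}). \<forall>g\<in>carrier G. \<forall>c.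
        emeasure M' (mono_part G \<phi>' M' f' g c) = emeasure M (mono_part G \<phi> M f g c)"
  shows "ms G \<phi>' M' r \<le> ms G \<phi> M r"
  unfolding pmp_action.ms_eq[OF assms(1)] pmp_action.ms_eq[OF assms(2)]
proof (intro Sup_subset_mono Collect_mono impI conjI ballI; elim conjE)
  fix \<epsilon> f
  assume *: "\<forall>f \<in> measurable M' (count_space {..<r}). \<exists>c. \<exists>g\<in>carrier G. g \<noteq> \<one>\<^bsub>G\<^esub> \<and>
      \<epsilon> \<le> emeasure M' (mono_part G \<phi>' M' f g c)"
    and f: "f \<in> measurable M (count_space {..<r})"
  obtain f' where f': "f' \<in> measurable M' (count_space {..<r})"
    and eq: "\<forall>g\<in>carrier G. \<forall>c.
        emeasure M' (mono_part G \<phi>' M' f' g c) = emeasure M (mono_part G \<phi> M f g c)"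
    using assms(3)[OF f] by blast
  obtain c g where "g \<in> carrier G" "g \<noteq> \<one>\<^bsub>G\<^esub>" "\<epsilon> \<le> emeasure M' (mono_part G \<phi>' M' f' g c)"
    using bspec[OF * f'] by blast
  then show "\<exists>c. \<exists>g\<in>carrier G. g \<noteq> \<one>\<^bsub>G\<^esub> \<and> \<epsilon> \<le> emeasure M (mono_part G \<phi> M f g c)"
    using eq by auto
qed

section \<open>Ternary coding, countable bases and distribution functions\<close>

text \<open>At the first index \<open>i\<close> where the digits differ, the terms differ by
  \<open>1 / 3 ^ i\<close>, while all later terms together contribute at most half of that. In base
  2 the tail could compensate.\<close>

lemma ternary_expansion_unique:
  fixes a b :: "nat \<Rightarrow> bool"
  assumes eq: "(\<Sum>i. of_bool (a i) / 3 ^ i :: real) = (\<Sum>i. of_bool (b i) / 3 ^ i)"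
  shows "a = b"
proof (rule ccontr)
  assume "a \<noteq> b"
  then have ex: "\<exists>i. a i \<noteq> b i" by auto
  define i where "i = (LEAST i. a i \<noteq> b i)"
  have i: "a i \<noteq> b i" unfolding i_def using ex by (rule LeastI_ex)
  have less: "a j = b j" if "j < i" for j using that not_less_Least unfolding i_def by blast
  have geo: "summable (\<lambda>j. 1 / 3 ^ j :: real)"
    using summable_geometric[of "1/3 :: real"] by (simp add: power_divide)
  have summ: "summable (\<lambda>j. of_bool (c j) / 3 ^ j :: real)" for c :: "nat \<Rightarrow> bool"
    using geo by (rule summable_comparison_test') (auto simp: of_bool_def)
  define d :: "nat \<Rightarrow> real" where "d j = of_bool (a j) / 3 ^ j - of_bool (b j) / 3 ^ j" for j
  have d: "summable d" "suminf d = 0"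
    using summ[of a] summ[of b] eq suminf_diff[OF summ[of a] summ[of b]]
    by (auto simp: d_def[abs_def] intro: summable_diff)
  have norm_d: "norm (d j) \<le> 1 / 3 ^ j" for j
    by (auto simp: d_def of_bool_def)
  have "0 = (\<Sum>j. d (j + Suc i)) + (\<Sum>j<Suc i. d j)"
    using suminf_split_initial_segment[OF d(1), of "Suc i"] d(2) by simp
  also have "(\<Sum>j<Suc i. d j) = d i"
    using less by (simp add: d_def)
  finally have "\<bar>d i\<bar> = \<bar>\<Sum>j. d (j + Suc i)\<bar>" by linarith
  also have "\<dots> \<le> (\<Sum>j. 1 / 3 ^ (j + Suc i))"
    unfolding real_norm_def[symmetric]
    by (rule norm_suminf_le[OF norm_d summable_ignore_initial_segment[OF geo]])
  also have "(\<Sum>j. 1 / 3 ^ (j + Suc i) :: real) = (\<Sum>j. (1 / 3 ^ Suc i) * (1 / 3) ^ j)"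
    by (simp add: power_add power_divide mult_ac)
  also have "\<dots> = (1 / 3 ^ Suc i) * (3 / 2)"
    by (subst suminf_mult) (auto simp: suminf_geometric intro: summable_geometric)
  also have "\<dots> < 1 / 3 ^ i" by (simp add: field_simps)
  also have "1 / 3 ^ i = \<bar>d i\<bar>" using i by (auto simp: d_def of_bool_def)
  finally show False by simp
qed

text \<open>Total boundedness yields a finite net for each radius \<open>1 / Suc n\<close>; the
  balls about all net points form a countable base.\<close>

lemma compact_metrizable_imp_second_countable:
  assumes "compact_space X" "metrizable_space X"
  shows "second_countable X"
proof -
  obtain M d where "Metric_space M d" and X: "X = Metric_space.mtopology M d"
    using assms(2) unfolding metrizable_space_def by blast
  interpret Metric_space M d by fact
  have "mtotally_bounded M"
    using assms(1) compactin_imp_mtotally_bounded by (simp add: X compact_space_def)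
  then have "\<exists>K. finite K \<and> K \<subseteq> M \<and> M \<subseteq> (\<Union>x\<in>K. mball x (1 / Suc n))" for n
    by (simp add: mtotally_bounded_def)
  then obtain K where K: "\<And>n. finite (K n)" "\<And>n. M \<subseteq> (\<Union>x\<in>K n. mball x (1 / Suc n))"
    by metis
  define \<B> where "\<B> = (\<Union>n. (\<lambda>x. mball x (1 / Suc n)) ` K n)"
  have "countable \<B>"
    unfolding \<B>_def using countable_finite[OF K(1)] by (intro countable_UN countable_image countableI_type)
  moreover have "\<forall>V\<in>\<B>. openin X V"
    by (auto simp: \<B>_def X)
  moreover have "\<exists>V\<in>\<B>. x \<in> V \<and> V \<subseteq> U" if U: "openin X U" "x \<in> U" for U x
  proof -
    obtain e where e: "0 < e" "mball x e \<subseteq> U" and "x \<in> M"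
      using U unfolding X openin_mtopology by blast
    obtain n where n: "1 / Suc n < e / 2"
      using nat_approx_posE[of "e / 2"] e(1) by auto
    obtain y where y: "y \<in> K n" "x \<in> mball y (1 / Suc n)"
      using K(2)[of n] \<open>x \<in> M\<close> by blast
    have "mball y (1 / Suc n) \<subseteq> mball x e"
    proof
      fix z assume z: "z \<in> mball y (1 / Suc n)"
      have "d x z \<le> d y x + d y z"
        using y z triangle[of x y z] commute[of x y] by auto
      also have "\<dots> < e" using y z n by auto
      finally show "z \<in> mball x e" using z y by auto
    qed
    then show ?thesis using y e(2) by (auto simp: \<B>_def intro!: exI[of _ n] bexI[of _ y])
  qed
  ultimately show ?thesis unfolding second_countable_def by blast
qed

text \<open>The probability integral transform: an atomless law is made uniform by its own
  distribution function. The quantile function \<open>I\<close> carries the uniform measure to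
  \<open>M\<close>, and \<open>C\<close> undoes \<open>I\<close> on the open unit interval.\<close>

lemma (in cdf_distribution) emeasure_vimage_cdf:
  assumes cont: "\<And>x. measure M {x} = 0" and S: "S \<in> sets borel" "S \<subseteq> {0..1}"
  shows "emeasure M (C -` S) = emeasure lborel S"
proof -
  have C_I: "C (I \<omega>) = \<omega>" if \<omega>: "0 < \<omega>" "\<omega> < 1" for \<omega>
  proof (rule ccontr)
    assume "C (I \<omega>) \<noteq> \<omega>"
    moreover have "\<omega> \<le> C (I \<omega>)" using pseudoinverse[OF \<omega>, of "I \<omega>"] by simp
    ultimately have "\<omega> < C (I \<omega>)" by simp
    \<comment> \<open>If \<open>C\<close> overshoots \<open>\<omega>\<close> at
      \<open>I \<omega>\<close>, then by continuity it already exceeds \<open>\<omega>\<close>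
      slightly to the left, against the minimality of \<open>I \<omega>\<close>.\<close>
    moreover have "isCont C (I \<omega>)" using isCont_cdf cont by blast
    then have "(C \<longlongrightarrow> C (I \<omega>)) (at_left (I \<omega>))"
      unfolding isCont_def by (rule filterlim_mono) (auto simp: at_le)
    ultimately have "eventually (\<lambda>x. \<omega> < C x) (at_left (I \<omega>))"
      using order_tendstoD(1) by blast
    moreover have "eventually (\<lambda>x. x < I \<omega>) (at_left (I \<omega>))"
      by (simp add: eventually_at_filter)
    ultimately have "eventually (\<lambda>x. \<omega> < C x \<and> x < I \<omega>) (at_left (I \<omega>))"
      by eventually_elim simp
    then obtain x where "\<omega> < C x" "x < I \<omega>"
      using eventually_happens'[OF trivial_limit_at_left_real] by blast
    then show False using pseudoinverse[OF \<omega>, of x] by simp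
  qed
  have CS: "C -` S \<in> sets borel"
    using measurable_sets[OF measurable_C S(1)] by simp
  have "emeasure M (C -` S) = emeasure (distr (restrict_space lborel {0<..<1}) borel I) (C -` S)"
    by (simp add: distr_I_eq_M)
  also have "\<dots> = emeasure lborel {t \<in> {0<..<1}. I t \<in> C -` S}"
    using CS measurable_CI
    by (subst emeasure_distr)
       (auto simp: emeasure_restrict_space space_restrict_space
             cong: measurable_cong_sets intro!: arg_cong[of _ _ "emeasure lborel"])
  also have "{t \<in> {0<..<1}. I t \<in> C -` S} = S \<inter> {0<..<1}"
    using C_I by auto
  also have "emeasure lborel (S \<inter> {0<..<1}) = emeasure lborel S"
  proof (rule emeasure_eq_AE)
    show "AE t in lborel. t \<in> S \<inter> {0<..<1} \<longleftrightarrow> t \<in> S"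
      using AE_lborel_singleton[of "0::real"] AE_lborel_singleton[of "1::real"]
    proof eventually_elim
      case (elim t)
      then show ?case using S(2) by force
    qed
  qed (use S in auto)
  finally show ?thesis .
qed

section \<open>Fundamental domains and pulling colorings back to \<open>X\<close>\<close>

text \<open>A point is kept if it lies in the first \<open>B i\<close> that its orbit meets. Points
  of one orbit share this index, so two kept points of an orbit lie in the same \<open>B i\<close>,
  where \<open>free\<close> applies.\<close>

lemma (in pmp_action) ex_fundamental_domain:
  fixes B :: "nat \<Rightarrow> 'x set"
  assumes B: "\<And>i. B i \<in> sets M"
    and free: "\<And>i g x. g \<in> carrier G \<Longrightarrow> x \<in> B i \<Longrightarrow> \<phi> g x \<in> B i \<Longrightarrow> g = \<one>"
    and cover: "AE x in M. \<exists>i. x \<in> B i"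
  obtains D where "D \<in> sets M"
    "\<And>g x. g \<in> carrier G \<Longrightarrow> x \<in> D \<Longrightarrow> \<phi> g x \<in> D \<Longrightarrow> g = \<one>"
    "AE x in M. \<exists>g\<in>carrier G. \<phi> g x \<in> D"
proof -
  define D where "D = {x \<in> space M. \<exists>i. x \<in> B i \<and> (\<forall>j<i. \<forall>h\<in>carrier G. \<phi> h x \<notin> B j)}"
  have "D \<in> sets M"
  proof -
    have [measurable]: "Measurable.pred M (\<lambda>x. \<phi> h x \<in> B i)" if "h \<in> carrier G" for h i
      using measurable_sets[OF measurable_action[OF that] B, of i]
      by (simp add: pred_def vimage_def Int_def conj_commute)
    have [measurable]: "Measurable.pred M (\<lambda>x. x \<in> B i)" for i
      using B by measurable
    have [measurable]: "Measurable.pred M (\<lambda>x. \<forall>h\<in>carrier G. \<phi> h x \<notin> B j)" for j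
      using finite_carrier by measurable
    show ?thesis unfolding D_def by measurable
  qed
  moreover have "g = \<one>" if g: "g \<in> carrier G" and x: "x \<in> D" "\<phi> g x \<in> D" for g x
  proof -
    obtain i where i: "x \<in> B i" "\<And>j h. j < i \<Longrightarrow> h \<in> carrier G \<Longrightarrow> \<phi> h x \<notin> B j"
      using x(1) by (auto simp: D_def)
    obtain i' where i': "\<phi> g x \<in> B i'" "\<And>j h. j < i' \<Longrightarrow> h \<in> carrier G \<Longrightarrow> \<phi> h (\<phi> g x) \<notin> B j"
      using x(2) by (auto simp: D_def)
    have "\<phi> (inv g) (\<phi> g x) = x"
      using x g by (intro orbit_sym_aux) (auto simp: D_def)
    then have "\<not> i < i'" using i(1) i'(2)[of i "inv g"] g by auto
    moreover have "\<not> i' < i" using i(2)[of i' g] i'(1) g by auto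
    ultimately have "i = i'" by simp
    then show ?thesis using free[OF g i(1)] i'(1) by simp
  qed
  moreover have "AE x in M. \<exists>g\<in>carrier G. \<phi> g x \<in> D"
    using cover AE_space
  proof eventually_elim
    case (elim x)
    then have ex: "\<exists>i. \<exists>h\<in>carrier G. \<phi> h x \<in> B i"
      using action_one by (metis one_closed)
    define i where "i = (LEAST i. \<exists>h\<in>carrier G. \<phi> h x \<in> B i)"
    obtain h where h: "h \<in> carrier G" "\<phi> h x \<in> B i"
      using LeastI_ex[OF ex] unfolding i_def by blast
    have "\<phi> k (\<phi> h x) \<notin> B j" if "j < i" "k \<in> carrier G" for j k
      using not_less_Least[OF that(1)[unfolded i_def]] that h elim(2) composition_rule[of x k h]
      by (metis m_closed)
    then have "\<phi> h x \<in> D"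
      using h action_in_space[OF h(1) elim(2)] by (auto simp: D_def)
    then show ?case using h by blast
  qed
  ultimately show ?thesis by (rule that)
qed

text \<open>If \<open>h\<close> is the element moving \<open>x\<close> into \<open>D\<close>, then
  \<open>x\<close> is sent to \<open>(inv h, T (\<phi> h x))\<close>. This is equivariant, and
  measure preserving because \<open>T\<close> is uniform on \<open>D\<close>; \<open>f\<close> is
  the pullback of \<open>f'\<close>.\<close>

lemma (in pmp_action) ex_colouring_of_cylinder_colouring:
  fixes \<tau> :: "'x \<Rightarrow> real"
  assumes D: "D \<in> sets M"
    and free: "\<And>g x. g \<in> carrier G \<Longrightarrow> x \<in> D \<Longrightarrow> \<phi> g x \<in> D \<Longrightarrow> g = \<one>"
    and cover: "AE x in M. \<exists>g\<in>carrier G. \<phi> g x \<in> D"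
    and \<tau>: "\<tau> \<in> borel_measurable M"
    and atomless: "\<And>y. emeasure M (\<tau> -` {y} \<inter> space M) = 0"
    and f': "f' \<in> measurable (cylinder_measure G) (count_space {..<r})"
  obtains f where "f \<in> measurable M (count_space {..<r})"
    "\<And>g c. g \<in> carrier G \<Longrightarrow> emeasure M (mono_part G \<phi> M f g c) =
      emeasure (cylinder_measure G) (mono_part G (cylinder_action G) (cylinder_measure G) f' g c)"
proof -
  interpret C: pmp_action G "cylinder_measure G" "cylinder_action G"
    by (rule pmp_action_cylinder[OF finite_carrier])
  have DM: "D \<subseteq> space M" using D by (rule sets.sets_into_space)
  have hit_unique: "h = h'" if "h \<in> carrier G" "h' \<in> carrier G" "x \<in> space M" "\<phi> h x \<in> D" "\<phi> h' x \<in> D" for h h' x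
  proof -
    have "\<phi> (h' \<otimes> inv h) (\<phi> h x) = \<phi> h' x"
      using that orbit_sym_aux[of h x "\<phi> h x"] composition_rule[of "\<phi> h x" h' "inv h"] action_in_space
      by simp
    then have "h' \<otimes> inv h = \<one>" using that free[of "h' \<otimes> inv h" "\<phi> h x"] by simp
    then show ?thesis using that by (metis inv_closed inv_equality inv_inv)
  qed
  \<comment> \<open>Almost every point is moved into \<open>D\<close> by exactly one group element,
    which splits \<open>A\<close> into disjoint pieces up to a null set.\<close>
  have slices: "emeasure M A = (\<Sum>h\<in>carrier G. emeasure M {x \<in> A. \<phi> h x \<in> D})"
    if A: "A \<in> sets M" for A
  proof -
    have meas: "{x \<in> A. \<phi> h x \<in> D} \<in> sets M" if "h \<in> carrier G" for h
    proof -
      have "{x \<in> A. \<phi> h x \<in> D} = A \<inter> (\<phi> h -` D \<inter> space M)"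
        using sets.sets_into_space[OF A] by auto
      then show ?thesis using A measurable_sets[OF measurable_action[OF that] D] by simp
    qed
    have "emeasure M A = emeasure M (\<Union>h\<in>carrier G. {x \<in> A. \<phi> h x \<in> D})"
    proof (rule emeasure_eq_AE)
      show "AE x in M. x \<in> A \<longleftrightarrow> x \<in> (\<Union>h\<in>carrier G. {x \<in> A. \<phi> h x \<in> D})"
        using cover by eventually_elim auto
    qed (use A meas finite_carrier in auto)
    also have "\<dots> = (\<Sum>h\<in>carrier G. emeasure M {x \<in> A. \<phi> h x \<in> D})"
    proof (rule sum_emeasure[symmetric])
      show "disjoint_family_on (\<lambda>h. {x \<in> A. \<phi> h x \<in> D}) (carrier G)"
        using hit_unique sets.sets_into_space[OF A] unfolding disjoint_family_on_def by blast
    qed (use meas finite_carrier in auto)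
    finally show ?thesis .
  qed
  have emeasure_D: "emeasure M D = ennreal (1 / order G)"
  proof -
    have "emeasure M (\<phi> h -` D \<inter> space M) = emeasure M {x \<in> space M. \<phi> h x \<in> D}" for h
      by (intro arg_cong[of _ _ "emeasure M"]) auto
    then have "1 = of_nat (order G) * emeasure M D"
      using slices[OF sets.top] emeasure_space_1 emeasure_vimage_action[OF _ D] by (simp add: order_def)
    then have "ennreal (1 / order G) = ennreal (1 / order G) * (ennreal (order G) * emeasure M D)"
      by (simp add: ennreal_of_nat_eq_real_of_nat)
    also have "\<dots> = emeasure M D"
      using order_pos by (simp add: mult.assoc[symmetric] flip: ennreal_mult')
    finally show ?thesis ..
  qed
  define U where "U = uniform_measure M D"
  have D_pos: "emeasure M D \<noteq> 0" "emeasure M D \<noteq> \<infinity>"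
    using emeasure_D order_pos by auto
  have \<tau>U: "\<tau> \<in> borel_measurable U" using \<tau> by (simp add: U_def)
  interpret U: prob_space U
    unfolding U_def using D_pos by (intro prob_space_uniform_measure) auto
  define N where "N = distr U borel \<tau>"
  interpret N: cdf_distribution N
    unfolding N_def using \<tau>U by (intro cdf_distribution.intro U.real_distribution_distr)
  have N_atomless: "measure N {y} = 0" for y
  proof -
    have "emeasure N {y} = emeasure U (\<tau> -` {y} \<inter> space M)"
      unfolding N_def using emeasure_distr[OF \<tau>U, of "{y}"] by (simp add: U_def)
    also have "\<dots> = emeasure M (D \<inter> (\<tau> -` {y} \<inter> space M)) / emeasure M D"
      unfolding U_def using D measurable_sets[OF \<tau>, of "{y}"] by (intro emeasure_uniform_measure) auto
    also have "emeasure M (D \<inter> (\<tau> -` {y} \<inter> space M)) = 0"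
      by (rule emeasure_eq_0[OF measurable_sets[OF \<tau>] atomless[of y]]) auto
    finally show ?thesis by (simp add: measure_def)
  qed
  \<comment> \<open>\<open>N\<close> is the law of \<open>\<tau>\<close> under the normalized
    restriction to \<open>D\<close>, so by the probability integral transform \<open>T\<close> is
    uniform on \<open>D\<close>.\<close>
  define T where "T x = cdf N (\<tau> x)" for x
  have T: "T \<in> borel_measurable M"
    unfolding T_def using \<tau> by measurable
  have T01: "T x \<in> {0..1}" for x
    using N.cdf_nonneg N.cdf_bounded_prob by (simp add: T_def)
  have emeasure_T: "emeasure M {y \<in> D. T y \<in> S} = ennreal (1 / order G) * emeasure lborel S"
    if S: "S \<in> sets borel" "S \<subseteq> {0..1}" for S
  proof -
    have CS: "cdf N -` S \<in> sets borel"
      using measurable_sets[OF N.measurable_C S(1)] by simp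
    have "emeasure lborel S = emeasure N (cdf N -` S)"
      using N.emeasure_vimage_cdf[OF N_atomless S] by simp
    also have "\<dots> = emeasure U (\<tau> -` (cdf N -` S) \<inter> space M)"
      unfolding N_def[symmetric] using emeasure_distr[OF \<tau>U CS] by (simp add: U_def N_def)
    also have "\<dots> = emeasure M (D \<inter> (\<tau> -` (cdf N -` S) \<inter> space M)) / emeasure M D"
      unfolding U_def using D measurable_sets[OF \<tau> CS] by (intro emeasure_uniform_measure)
    also have "D \<inter> (\<tau> -` (cdf N -` S) \<inter> space M) = {y \<in> D. T y \<in> S}"
      using DM by (auto simp: T_def)
    finally have "emeasure M D * emeasure lborel S = emeasure M {y \<in> D. T y \<in> S}"
      using D_pos by (simp add: ennreal_times_divide ennreal_mult_divide_eq mult.commute[of "emeasure M D"])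
    then show ?thesis by (simp add: emeasure_D)
  qed
  define H where "H x = (THE h. h \<in> carrier G \<and> \<phi> h x \<in> D)" for x
  \<comment> \<open>The inverse appears because \<open>x\<close> is the translate by
    \<open>inv (H x)\<close> of a point of \<open>D\<close>. Points whose orbit misses
    \<open>D\<close> form a null set and get color 0.\<close>
  define f where "f x = (if \<exists>h\<in>carrier G. \<phi> h x \<in> D then f' (inv (H x), T (\<phi> (H x) x)) else 0)" for x
  have f_slice: "f x = f' (inv h, T (\<phi> h x))"
    if "h \<in> carrier G" "x \<in> space M" "\<phi> h x \<in> D" for h x
  proof -
    have "H x = h" unfolding H_def using that hit_unique by blast
    then show ?thesis using that by (auto simp: f_def)
  qed
  \<comment> \<open>Equivariance: \<open>h \<otimes> inv a\<close> brings \<open>\<phi> a x\<close>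
    to the same point of \<open>D\<close>, so the interval coordinate is unchanged and the group
    coordinate is multiplied by \<open>a\<close> on the left.\<close>
  have f_act: "f (\<phi> a x) = f' (a \<otimes> inv h, T (\<phi> h x))"
    if "a \<in> carrier G" "h \<in> carrier G" "x \<in> space M" "\<phi> h x \<in> D" for a h x
  proof -
    have "\<phi> (h \<otimes> inv a) (\<phi> a x) = \<phi> h x"
      using that orbit_sym_aux[of a x "\<phi> a x"] composition_rule[of "\<phi> a x" h "inv a"] action_in_space
      by simp
    then show ?thesis
      using f_slice[of "h \<otimes> inv a" "\<phi> a x"] that action_in_space by (simp add: inv_mult_group)
  qed
  obtain h0 t0 where "(h0, t0) \<in> space (cylinder_measure G)" using C.not_empty by auto
  then have r: "0 < r" using measurable_space[OF f'] by fastforce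
  have slice_measurable: "(\<lambda>y. f' (h, T y)) \<in> measurable M (count_space {..<r})" if "h \<in> carrier G" for h
  proof -
    have "(\<lambda>y. (h, T y)) \<in> measurable M (cylinder_measure G)"
      using that T T01 by (auto simp: measurable_cong_sets[OF refl sets_cylinder_measure]
          intro!: measurable_Pair measurable_restrict_space2)
    then show ?thesis using f' by (rule measurable_compose)
  qed
  have f_less: "f x < r" if "x \<in> space M" for x
  proof (cases "\<exists>h\<in>carrier G. \<phi> h x \<in> D")
    case True
    then obtain h where h: "h \<in> carrier G" "\<phi> h x \<in> D" by blast
    then show ?thesis
      using f_slice[OF h(1) that h(2)] measurable_space[OF slice_measurable, of "inv h" "\<phi> h x"] action_in_space that
      by simp
  qed (use r in \<open>simp add: f_def\<close>)
  have f: "f \<in> measurable M (count_space {..<r})"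
  proof -
    have "f -` {j} \<inter> space M \<in> sets M" for j
    proof -
      have pr: "Measurable.pred M (\<lambda>x. \<phi> h x \<in> D)" if "h \<in> carrier G" for h
        using measurable_sets[OF measurable_action[OF that] D]
        by (simp add: pred_def vimage_def Int_def conj_commute)
      have pr2: "Measurable.pred M (\<lambda>x. f' (inv h, T (\<phi> h x)) = j)" if "h \<in> carrier G" for h
        using measurable_compose[OF measurable_action[OF that] slice_measurable[of "inv h"]] that by simp
      have "f -` {j} \<inter> space M = {x \<in> space M.
          (\<exists>h\<in>carrier G. \<phi> h x \<in> D \<and> f' (inv h, T (\<phi> h x)) = j) \<or>
          (\<forall>h\<in>carrier G. \<phi> h x \<notin> D) \<and> j = 0}" (is "_ = ?R")
      proof (rule Set.set_eqI)
        fix x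
        show "x \<in> f -` {j} \<inter> space M \<longleftrightarrow> x \<in> ?R"
        proof (cases "\<exists>h\<in>carrier G. \<phi> h x \<in> D")
          case True
          then show ?thesis using f_slice by auto
        next
          case False
          then show ?thesis by (auto simp: f_def)
        qed
      qed
      also have "\<dots> \<in> sets M"
        using finite_carrier pr pr2 by measurable
      finally show ?thesis .
    qed
    then show ?thesis
      using f_less by (subst measurable_count_space_eq2) auto
  qed
  show ?thesis
  proof (rule that[OF f])
    fix g c assume g: "g \<in> carrier G"
    let ?E = "mono_part G \<phi> M f g c"
    let ?E' = "mono_part G (cylinder_action G) (cylinder_measure G) f' g c"
    have E': "?E' \<in> sets (cylinder_measure G)" using C.sets_mono_part[OF f' g] .
    \<comment> \<open>The piece belonging to \<open>h\<close> is the
      \<open>\<phi> h\<close>-preimage of a subset of \<open>D\<close> cut out by \<open>T\<close>,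
      so invariance and uniformity of \<open>T\<close> give its measure. Reindexing by inversion
      then restores the cylinder formula.\<close>
    have "emeasure M {x \<in> ?E. \<phi> h x \<in> D} = ennreal (1 / order G) * emeasure lborel (Pair (inv h) -` ?E')"
      if h: "h \<in> carrier G" for h
    proof -
      let ?S = "Pair (inv h) -` ?E'"
      have "{x \<in> ?E. \<phi> h x \<in> D} = \<phi> h -` {y \<in> D. T y \<in> ?S} \<inter> space M"
        using g h T01 f_act[OF nat_pow_closed[OF g] h] unfolding Pair_vimage_mono_part_cylinder[OF g inv_closed[OF h]]
        by (auto simp: mono_part_def)
      moreover have "{y \<in> D. T y \<in> ?S} \<in> sets M"
      proof -
        have "{y \<in> D. T y \<in> ?S} = D \<inter> (T -` ?S \<inter> space M)" using DM by auto
        then show ?thesis using D measurable_sets[OF T sets_cylinder_section(1)[OF E']] by simp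
      qed
      ultimately show ?thesis
        using emeasure_vimage_action[OF h] emeasure_T[OF sets_cylinder_section[OF E']] by (simp only:)
    qed
    then have "emeasure M ?E =
        (\<Sum>h\<in>carrier G. ennreal (1 / order G) * emeasure lborel (Pair (inv h) -` ?E'))"
      using slices[OF sets_mono_part[OF f g]] by simp
    also have "\<dots> = (\<Sum>h\<in>carrier G. ennreal (1 / order G) * emeasure lborel (Pair h -` ?E'))"
      by (intro sum.reindex_bij_witness[where i = "\<lambda>h. inv h" and j = "\<lambda>h. inv h"]) auto
    also have "\<dots> = emeasure (cylinder_measure G) ?E'"
      using emeasure_cylinder_measure[OF finite_carrier E'] by simp
    finally show "emeasure M ?E = emeasure (cylinder_measure G) ?E'" .
  qed
qed

section \<open>Borel sets and topology of the compact space\<close>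

lemma space_borel_of: "space (borel_of X) = topspace X"
  unfolding borel_of_def by (rule space_measure_of) (auto dest: openin_subset)

lemma sets_borel_of: "sets (borel_of X) = sigma_sets (topspace X) {U. openin X U}"
  unfolding borel_of_def by (rule sets_measure_of) (auto dest: openin_subset)

lemma measurable_borel_of:
  assumes "continuous_map X Y f" "sets M = sets (borel_of X)" "sets N = sets (borel_of Y)"
  shows "f \<in> measurable M N"
proof -
  have sp: "space M = topspace X" using sets_eq_imp_space_eq[OF assms(2)] by (simp add: space_borel_of)
  have "f \<in> measurable M (borel_of Y)"
    unfolding borel_of_def
  proof (rule measurable_measure_of)
    show "f \<in> space M \<rightarrow> topspace Y"
      using assms(1) by (auto simp: continuous_map_def sp)
    fix U assume "U \<in> {U. openin Y U}"
    then have "openin X {x \<in> topspace X. f x \<in> U}"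
      using assms(1) by (auto simp: continuous_map_def)
    moreover have "f -` U \<inter> space M = {x \<in> topspace X. f x \<in> U}" using sp by auto
    ultimately show "f -` U \<inter> space M \<in> sets M"
      by (auto simp: assms(2) sets_borel_of)
  qed (auto dest: openin_subset)
  then show ?thesis using measurable_cong_sets[OF refl assms(3)] by blast
qed

text \<open>The preimage under \<open>g\<close> is the image under the inverse of \<open>g\<close>,
  which turns \<open>invariant_measure\<close> into the preimage form.\<close>

lemma pmp_action_of_continuous_action:
  assumes "finite (carrier G)" "continuous_group_action G X \<phi>"
    and "prob_space \<mu>" "sets \<mu> = sets (borel_of X)" "invariant_measure G \<phi> \<mu>"
  shows "pmp_action G \<mu> \<phi>"
proof -
  have sp: "space \<mu> = topspace X"
    using sets_eq_imp_space_eq[OF assms(4)] by (simp add: space_borel_of)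
  interpret group_action G "space \<mu>" \<phi>
    using assms(2) by (simp add: continuous_group_action_def sp)
  interpret group G using group_hom group_hom.axioms(1) by auto
  have "emeasure \<mu> (\<phi> g -` A \<inter> space \<mu>) = emeasure \<mu> A"
    if g: "g \<in> carrier G" and A: "A \<in> sets \<mu>" for g A
  proof -
    have AM: "A \<subseteq> space \<mu>" using A by (rule sets.sets_into_space)
    have "\<phi> g -` A \<inter> space \<mu> = \<phi> (inv\<^bsub>G\<^esub> g) ` A"
    proof (intro equalityI subsetI)
      fix x assume "x \<in> \<phi> g -` A \<inter> space \<mu>"
      then show "x \<in> \<phi> (inv\<^bsub>G\<^esub> g) ` A"
        using orbit_sym_aux[OF g, of x "\<phi> g x"] by (intro image_eqI[of _ _ "\<phi> g x"]) auto
    next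
      fix x assume "x \<in> \<phi> (inv\<^bsub>G\<^esub> g) ` A"
      then obtain a where a: "a \<in> A" "x = \<phi> (inv\<^bsub>G\<^esub> g) a" by auto
      have "\<phi> (inv\<^bsub>G\<^esub> (inv\<^bsub>G\<^esub> g)) x = a"
        using orbit_sym_aux[OF inv_closed[OF g], of a x] a AM by auto
      moreover have "x \<in> space \<mu>" using a AM g element_image[of "inv\<^bsub>G\<^esub> g" a x] by auto
      ultimately show "x \<in> \<phi> g -` A \<inter> space \<mu>" using a g by simp
    qed
    then show ?thesis
      using assms(5) g A by (simp add: invariant_measure_def)
  qed
  moreover have "\<phi> g \<in> measurable \<mu> \<mu>" if "g \<in> carrier G" for g
    using assms(2,4) that by (intro measurable_borel_of) (auto simp: continuous_group_action_def)
  ultimately show ?thesis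
    using assms(1,3) group_action_axioms by (intro pmp_action.intro pmp_action_axioms.intro) auto
qed

text \<open>An orbit of full size means that distinct group elements move \<open>x\<close> to
  distinct points. For each \<open>g \<noteq> \<one>\<close>, separating \<open>x\<close> from
  \<open>\<phi> g x\<close> and using continuity gives a neighborhood disjoint from its
  \<open>g\<close>-translate; finitely many of these are intersected.\<close>

lemma (in group_action) ex_wandering_nbhd:
  assumes X: "topspace X = E" "Hausdorff_space X" and fin: "finite (carrier G)"
    and cont: "\<And>g. g \<in> carrier G \<Longrightarrow> continuous_map X X (\<phi> g)"
    and x: "x \<in> E" "card (orbit G \<phi> x) = order G"
  obtains W where "openin X W" "x \<in> W"
    "\<And>g y. g \<in> carrier G \<Longrightarrow> y \<in> W \<Longrightarrow> \<phi> g y \<in> W \<Longrightarrow> g = \<one>"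
proof -
  interpret group G using group_hom group_hom.axioms(1) by auto
  have one: "\<phi> \<one> x = x" using id_eq_one x(1) by (metis restrict_apply')
  have "orbit G \<phi> x = (\<lambda>g. \<phi> g x) ` carrier G" by (auto simp: orbit_def)
  then have inj: "inj_on (\<lambda>g. \<phi> g x) (carrier G)"
    using x(2) fin by (intro eq_card_imp_inj_on) (auto simp: order_def)
  have "\<exists>W. openin X W \<and> x \<in> W \<and> (\<forall>y\<in>W. \<phi> g y \<notin> W)" if g: "g \<in> carrier G - {\<one>}" for g
  proof -
    have "\<phi> g x \<noteq> x" using inj_onD[OF inj, of g \<one>] g one by auto
    moreover have "\<phi> g x \<in> E" using g x element_image by blast
    ultimately obtain U V where UV: "openin X U" "openin X V" "x \<in> U" "\<phi> g x \<in> V" "disjnt U V"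
      using X x(1) unfolding Hausdorff_space_def by metis
    have "openin X {y \<in> topspace X. \<phi> g y \<in> V}"
      using cont g UV(2) by (auto simp: continuous_map_def)
    then show ?thesis
      using UV X x(1) by (intro exI[of _ "U \<inter> {y \<in> topspace X. \<phi> g y \<in> V}"])
        (auto simp: disjnt_def)
  qed
  then obtain W where W: "\<And>g. g \<in> carrier G - {\<one>} \<Longrightarrow> openin X (W g) \<and> x \<in> W g \<and> (\<forall>y\<in>W g. \<phi> g y \<notin> W g)"
    by metis
  show ?thesis
  proof (rule that)
    \<comment> \<open>The factor \<open>topspace X\<close> takes care of the trivial group, where
      the family is empty.\<close>
    let ?W = "topspace X \<inter> \<Inter> (W ` (carrier G - {\<one>}))"
    show "openin X ?W"
      using W fin by (intro openin_Int_Inter) auto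
    show "x \<in> ?W" using W X x by auto
    show "g = \<one>" if "g \<in> carrier G" "y \<in> ?W" "\<phi> g y \<in> ?W" for g y
    proof (rule ccontr)
      assume "g \<noteq> \<one>"
      then have "g \<in> carrier G - {\<one>}" using that by simp
      then show False using W[of g] that by blast
    qed
  qed
qed

text \<open>Membership of a point in the sets of a countable base is recorded as a sequence of
  ternary digits 0 and 1. The base separates points, and such digits are determined by their
  sum.\<close>

lemma ex_injective_borel_map:
  assumes "second_countable X" "Hausdorff_space X" "sets M = sets (borel_of X)"
  obtains \<tau> :: "'x \<Rightarrow> real" where "\<tau> \<in> borel_measurable M" "inj_on \<tau> (topspace X)"
proof -
  obtain \<B> where \<B>: "countable \<B>" "\<And>V. V \<in> \<B> \<Longrightarrow> openin X V"
    "\<And>U x. openin X U \<Longrightarrow> x \<in> U \<Longrightarrow> \<exists>V\<in>\<B>. x \<in> V \<and> V \<subseteq> U"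
    using assms(1) unfolding second_countable_def by metis
  \<comment> \<open>The empty set is added because enumeration by \<open>from_nat_into\<close>
    requires a nonempty family; its digit is always 0.\<close>
  define B where "B = from_nat_into (insert {} \<B>)"
  have rangeB: "range B = insert {} \<B>"
    unfolding B_def using \<B>(1) by (intro range_from_nat_into) auto
  then have openB: "openin X (B i)" for i
    using \<B>(2) by (metis insert_iff openin_empty rangeI)
  then have setsB: "B i \<in> sets M" for i by (simp add: assms(3) sets_borel_of)
  define \<tau> :: "'x \<Rightarrow> real" where "\<tau> x = (\<Sum>i. of_bool (x \<in> B i) / 3 ^ i)" for x
  have "\<tau> \<in> borel_measurable M"
  proof -
    have "(\<lambda>x. of_bool (x \<in> B i) / 3 ^ i :: real) \<in> borel_measurable M" for i
    proof -
      have "(\<lambda>x. indicator (B i) x / 3 ^ i :: real) \<in> borel_measurable M"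
        using setsB by measurable
      then show ?thesis by (simp add: indicator_def of_bool_def)
    qed
    then show ?thesis unfolding \<tau>_def by (intro borel_measurable_suminf)
  qed
  moreover have "inj_on \<tau> (topspace X)"
  proof (rule inj_onI, rule ccontr)
    fix x y assume xy: "x \<in> topspace X" "y \<in> topspace X" "\<tau> x = \<tau> y" "x \<noteq> y"
    then obtain U where "openin X U" "x \<in> U" "y \<notin> U"
      using assms(2) unfolding Hausdorff_space_def disjnt_iff by metis
    then obtain V where "V \<in> \<B>" "x \<in> V" "y \<notin> V" using \<B>(3) by blast
    then obtain i where "x \<in> B i" "y \<notin> B i" using rangeB by (metis insertCI rangeE)
    moreover have "(\<lambda>i. x \<in> B i) = (\<lambda>i. y \<in> B i)"
      using xy(3) unfolding \<tau>_def by (rule ternary_expansion_unique)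
    ultimately show False by (metis (full_types))
  qed
  ultimately show ?thesis by (rule that)
qed

section \<open>Assembling the two inequalities\<close>

theorem theorem7p1:
  fixes G :: "('g, 'm) monoid_scheme"
    and X :: "'x topology"
    and \<phi> :: "'g \<Rightarrow> 'x \<Rightarrow> 'x"
    and \<mu> :: "'x measure"
    and r :: nat
  assumes "group G" and "finite (carrier G)"
    and "compact_space X" and "metrizable_space X"
    and "continuous_group_action G X \<phi>"
    and "prob_space \<mu>" and "sets \<mu> = sets (borel_of X)"
    and "invariant_measure G \<phi> \<mu>"
  shows "ms G \<phi> \<mu> r \<ge> ms G (cylinder_action G) (cylinder_measure G) r \<and>
    (continuous_measure \<mu> \<and> (AE x in \<mu>. card (orbit G \<phi> x) = order G) \<longrightarrow>
       ms G \<phi> \<mu> r = ms G (cylinder_action G) (cylinder_measure G) r)"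
proof -
  interpret pmp_action G \<mu> \<phi>
    using assms by (intro pmp_action_of_continuous_action)
  note cyl = pmp_action_cylinder[OF finite_carrier]
  have sp: "space \<mu> = topspace X"
    using sets_eq_imp_space_eq[OF assms(7)] by (simp add: space_borel_of)
  have "ms G (cylinder_action G) (cylinder_measure G) r \<le> ms G \<phi> \<mu> r"
  proof (rule ms_mono[OF pmp_action_axioms cyl])
    fix f assume f: "f \<in> measurable \<mu> (count_space {..<r})"
    show "\<exists>f'\<in>measurable (cylinder_measure G) (count_space {..<r}). \<forall>g\<in>carrier G. \<forall>c.
        emeasure (cylinder_measure G) (mono_part G (cylinder_action G) (cylinder_measure G) f' g c) =
        emeasure \<mu> (mono_part G \<phi> \<mu> f g c)"
      by (rule ex_cylinder_colouring[OF f]) blast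
  qed
  moreover have "ms G \<phi> \<mu> r \<le> ms G (cylinder_action G) (cylinder_measure G) r"
    if cont: "continuous_measure \<mu>" and free: "AE x in \<mu>. card (orbit G \<phi> x) = order G"
  proof -
    have cont_action: "continuous_map X X (\<phi> g)" if "g \<in> carrier G" for g
      using assms(5) that by (simp add: continuous_group_action_def)
    have haus: "Hausdorff_space X" using assms(4) by (rule metrizable_imp_Hausdorff_space)
    have sc: "second_countable X"
      using assms(3,4) by (rule compact_metrizable_imp_second_countable)
    obtain \<tau> :: "'x \<Rightarrow> real" where \<tau>: "\<tau> \<in> borel_measurable \<mu>" "inj_on \<tau> (topspace X)"
      using ex_injective_borel_map[OF sc haus assms(7)] .
    \<comment> \<open>Injectivity makes each fiber of \<open>\<tau>\<close> at most a single point,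
      so continuity of the measure passes to the law of \<open>\<tau>\<close>.\<close>
    have atomless: "emeasure \<mu> (\<tau> -` {y} \<inter> space \<mu>) = 0" for y
    proof (cases "\<exists>x\<in>space \<mu>. \<tau> x = y")
      case True
      then obtain x where "x \<in> space \<mu>" "\<tau> x = y" by blast
      then have "\<tau> -` {y} \<inter> space \<mu> = {x}" using \<tau>(2) by (auto simp: sp inj_on_def)
      then show ?thesis using cont \<open>x \<in> space \<mu>\<close> by (simp add: continuous_measure_def)
    next
      case False
      then have "\<tau> -` {y} \<inter> space \<mu> = {}" by auto
      then show ?thesis by simp
    qed
    obtain \<B> where \<B>: "countable \<B>" "\<And>V. V \<in> \<B> \<Longrightarrow> openin X V"
      "\<And>U x. openin X U \<Longrightarrow> x \<in> U \<Longrightarrow> \<exists>V\<in>\<B>. x \<in> V \<and> V \<subseteq> U"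
      using sc unfolding second_countable_def by metis
    \<comment> \<open>The basic open sets disjoint from their nontrivial translates. Disjointness
      passes to subsets, so a wandering neighborhood can be shrunk to a member; the empty set again
      ensures that an enumeration exists.\<close>
    define \<W> where "\<W> = insert {} {V \<in> \<B>. \<forall>g\<in>carrier G. \<forall>y\<in>V. \<phi> g y \<in> V \<longrightarrow> g = \<one>\<^bsub>G\<^esub>}"
    define B where "B = from_nat_into \<W>"
    have rangeB: "range B = \<W>"
      unfolding B_def using \<B>(1) by (intro range_from_nat_into) (auto simp: \<W>_def)
    have BW: "B i \<in> \<W>" for i using rangeB by blast
    have "openin X (B i)" for i
      using BW[of i] \<B>(2) by (auto simp: \<W>_def)
    then have B: "B i \<in> sets \<mu>" for i
      by (simp add: assms(7) sets_borel_of)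
    have B_free: "g = \<one>\<^bsub>G\<^esub>" if "g \<in> carrier G" "x \<in> B i" "\<phi> g x \<in> B i" for i g x
      using BW[of i] that by (auto simp: \<W>_def)
    have B_cover: "AE x in \<mu>. \<exists>i. x \<in> B i"
      using free AE_space
    proof eventually_elim
      case (elim x)
      obtain W where W: "openin X W" "x \<in> W"
        "\<And>g y. g \<in> carrier G \<Longrightarrow> y \<in> W \<Longrightarrow> \<phi> g y \<in> W \<Longrightarrow> g = \<one>\<^bsub>G\<^esub>"
        by (rule ex_wandering_nbhd[OF sp[symmetric] haus finite_carrier cont_action elim(2,1)]) (assumption, rule that)
      then obtain V where V: "V \<in> \<B>" "x \<in> V" "V \<subseteq> W" using \<B>(3) by blast
      then have "V \<in> \<W>" using W(3) by (auto simp: \<W>_def)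
      then show ?case using V(2) rangeB by (metis rangeE)
    qed
    obtain D where D: "D \<in> sets \<mu>"
      "\<And>g x. g \<in> carrier G \<Longrightarrow> x \<in> D \<Longrightarrow> \<phi> g x \<in> D \<Longrightarrow> g = \<one>\<^bsub>G\<^esub>"
      "AE x in \<mu>. \<exists>g\<in>carrier G. \<phi> g x \<in> D"
      by (rule ex_fundamental_domain[OF B B_free B_cover]) (assumption+, rule that)
    show ?thesis
    proof (rule ms_mono[OF cyl pmp_action_axioms])
      fix f' assume f': "f' \<in> measurable (cylinder_measure G) (count_space {..<r})"
      show "\<exists>f\<in>measurable \<mu> (count_space {..<r}). \<forall>g\<in>carrier G. \<forall>c.
          emeasure \<mu> (mono_part G \<phi> \<mu> f g c) =
          emeasure (cylinder_measure G) (mono_part G (cylinder_action G) (cylinder_measure G) f' g c)"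
        by (rule ex_colouring_of_cylinder_colouring[OF D \<tau>(1) atomless f']) blast+
    qed
  qed
  ultimately show ?thesis by (blast intro: antisym)
qed

end
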